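(* For the battery charging game with $T>2$ time steps and every integer $k$ with $1\le k\le T-2$, the $k$-strong price of anarchy for the class of all price profiles is $\mathrm{PoA}_{\mathrm{ANY}}^{k\text{-strong}}=\infty$.
   Context: **Battery charging game.** An instance consists of: a number of time steps $T\in\mathbb{N}$, with $[T]=\{1,\dots,T\}$; a finite directed graph $H=(V,E)$; for each $t\in[T]$ a copy $H_t=(V_t,E_t)$ of $H$ (the copy of $v\in V$ is $v_t$); a capacity $\kappa(e_t)\ge 0$ for each $e_t\in E_t$; a value $d(v_t)\in\mathbb{R}$ for each $v_t\in V_t$ (positive: supply, negative: demand); a finite set $B$ of battery agents, each $b\in B$ having a location $v^b\in V$, battery nodes $b_1,\dots,b_T$, and battery edges $(b_t,b_{t+1})$, $t\in[T-1]$, with capacities $\kappa((b_t,b_{t+1}))\ge 0$. For each $b,t$ there are two transaction edges $(b_t,v^b_t)$ and $(v^b_t,b_t)$ (with infinite capacity under $\kappa$). The graph $G$ is the union of all $H_t$, all battery nodes, battery edges and transaction edges. In addition there is a source $x$ with edges $(x,v_t)$ of capacity $\max(0,d(v_t))$ and a target $y$ with edges $(v_t,y)$ of capacity $\max(0,-d(v_t))$, for all $v_t\in V_t$, $t\in[T]$. **Strategies.** A strategy of agent $b$ is a vector $s_b=(s_{b,t})_{t\in[T]}\in\mathbb{R}^{[T]}$ (positive entries: charging, negative: discharging) with $0\le\sum_{z=1}^t s_{b,z}\le\kappa((b_t,b_{t+1}))$ for each $t\in[T-1]$. A strategy profile $\mathbf{s}$ consists of one strategy per agent. **Flow.** Given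 $\mathbf{s}$, $\kappa_{\mathbf{s}}$ is defined by $\kappa_{\mathbf{s}}((v^b_t,b_t))=\max(0,s_{b,t})$, $\kappa_{\mathbf{s}}((b_t,v^b_t))=\max(0,-s_{b,t})$, and $\kappa_{\mathbf{s}}=\kappa$ on all other edges; $G_{\mathbf{s}}$ is the graph $G$ (with $x,y$) with capacities $\kappa_{\mathbf{s}}$. Flows are (real-valued) feasible $x$-$y$-flows, the value $|f|$ being the flow out of $x$; a maximum flow is one of maximum value. **Admissibility.** A transaction edge $e$ is admissible for $\mathbf{s}$ if every maximum flow $f$ in $G_{\mathbf{s}}$ saturates it, i.e. $f(e)=\kappa_{\mathbf{s}}(e)$. A strategy $s_b$ is admissible for $\mathbf{s}$ if all transaction edges of agent $b$ are admissible; $\mathbf{s}$ is admissible if all its strategies are. **Utilities.** For a price profile $\mathbf{p}=(p_t)_{t\in[T]}\in\mathbb{R}^{[T]}$, $u_b(\mathbf{s},\mathbf{p})=-\infty$ if $s_b$ is not admissible for $\mathbf{s}$, and $u_b(\mathbf{s},\mathbf{p})=-\sum_{t\in[T]}s_{b,t}p_t$ otherwise. **$k$-strong equilibrium.** $\mathbf{s}$ is a $k$-strong equilibrium for $\mathbf{p}$ if there is no nonempty coalition $C\subseteq B$ of at most $k$ agents with strategies $\mathbf{s}'_C=(s'_b)_{b\in C}$ such that $u_b((\mathbf{s}'_C,\mathbf{s}_{-C}),\mathbf{p})>u_b(\mathbf{s},\mathbf{p})$ for all $b\in C$. **Welfare and price of anarchy.** $W(\mathbf{s})$ is the value of a maximum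 flow in $G_{\mathbf{s}}$; $\mathrm{OPT}(G)$ is a strategy profile of maximum welfare (over all strategy profiles). For a class $P$ of price profiles (prices may depend on $G$), $$\mathrm{PoA}_P^{k\text{-strong}}=\sup_G\ \inf_{\mathbf{p}\in P}\ \sup_{\mathbf{s}}\frac{W(\mathrm{OPT}(G))}{W(\mathbf{s})},$$ where $G$ ranges over all instances with the given number $T$ of time steps and $\mathbf{s}$ over all $k$-strong equilibria of $G$ for $\mathbf{p}$ (i.e. the ratio is taken with the worst $k$-strong equilibrium). Conventions: $0/0=1$, $a/0=\infty$ for $a>0$; the infimum is over those $\mathbf{p}\in P$ admitting a $k$-strong equilibrium and the outer supremum over those $G$ for which such $\mathbf{p}$ exists. **Price classes.** ANY: all price profiles in $\mathbb{R}^{[T]}$. *)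

theory Defs
  imports "HOL-Analysis.Analysis" "Graph_Theory.Pair_Digraph"
begin

section \<open>Maximum flows\<close>

definition is_flow ::
    "'a pair_pre_digraph \<Rightarrow> ('a \<times> 'a \<Rightarrow> real) \<Rightarrow> 'a \<Rightarrow> 'a \<Rightarrow> ('a \<times> 'a \<Rightarrow> real) \<Rightarrow> bool" where
  "is_flow G c x y f \<longleftrightarrow>
     (\<forall>e\<in>parcs G. 0 \<le> f e \<and> f e \<le> c e) \<and>
     (\<forall>v\<in>pverts G - {x, y}. (\<Sum>e\<in>in_arcs G v. f e) = (\<Sum>e\<in>out_arcs G v. f e))"

text \<open>The value counts only the outflow of the source; it is the net outflow
  whenever the source has no incoming arcs, as is the case below.\<close>

definition flow_value :: "'a pair_pre_digraph \<Rightarrow> 'a \<Rightarrow> ('a \<times> 'a \<Rightarrow> real) \<Rightarrow> real" where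
  "flow_value G x f = (\<Sum>e\<in>out_arcs G x. f e)"

definition is_max_flow ::
    "'a pair_pre_digraph \<Rightarrow> ('a \<times> 'a \<Rightarrow> real) \<Rightarrow> 'a \<Rightarrow> 'a \<Rightarrow> ('a \<times> 'a \<Rightarrow> real) \<Rightarrow> bool" where
  "is_max_flow G c x y f \<longleftrightarrow> is_arg_max (flow_value G x) (is_flow G c x y) f"

definition max_flow_value ::
    "'a pair_pre_digraph \<Rightarrow> ('a \<times> 'a \<Rightarrow> real) \<Rightarrow> 'a \<Rightarrow> 'a \<Rightarrow> real" where
  "max_flow_value G c x y = flow_value G x (SOME f. is_max_flow G c x y f)"

lemma max_flow_exists:
  fixes G :: "'a pair_pre_digraph"
  assumes "pair_fin_digraph G" and "\<And>e. e \<in> parcs G \<Longrightarrow> 0 \<le> c e"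
  shows "\<exists>f. is_max_flow G c x y f"
proof -
  interpret pair_fin_digraph G by fact
  define S where "S = {f. \<forall>e. f e \<in> (if e \<in> parcs G then {0..c e} else {0})}"
  define K where "K = S \<inter> (\<Inter>v\<in>pverts G - {x, y}.
    {f. (\<Sum>e\<in>in_arcs G v. f e) = (\<Sum>e\<in>out_arcs G v. f e)})"
  have "S = (\<Pi>\<^sub>E e\<in>UNIV. if e \<in> parcs G then {0..c e} else {0})"
    by (simp add: S_def PiE_UNIV_domain Pi_def)
  then have "compactin (product_topology (\<lambda>_. euclidean) UNIV) S"
    by (simp add: compactin_PiE)
  then have "compact S"
    by (simp add: euclidean_product_topology)
  moreover have "closed (\<Inter>v\<in>pverts G - {x, y}.
      {f :: 'a \<times> 'a \<Rightarrow> real. (\<Sum>e\<in>in_arcs G v. f e) = (\<Sum>e\<in>out_arcs G v. f e)})"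
    by (intro closed_INT ballI closed_Collect_eq continuous_on_sum continuous_on_product_coordinates)
  ultimately have "compact K"
    unfolding K_def by (rule compact_Int_closed)
  moreover have "(\<lambda>_. 0) \<in> K"
    using assms(2) by (simp add: K_def S_def)
  moreover have "continuous_on K (flow_value G x)"
    unfolding flow_value_def
    by (intro continuous_on_sum continuous_on_subset[OF continuous_on_product_coordinates]) auto
  ultimately obtain f where f: "f \<in> K" "\<And>g. g \<in> K \<Longrightarrow> flow_value G x g \<le> flow_value G x f"
    using continuous_attains_sup[of K "flow_value G x"] by blast
  have "flow_value G x g \<le> flow_value G x f" if g: "is_flow G c x y g" for g
  proof -
    let ?g = "\<lambda>e. if e \<in> parcs G then g e else 0"
    have eq: "sum ?g (in_arcs G v) = sum g (in_arcs G v)" "sum ?g (out_arcs G v) = sum g (out_arcs G v)"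
      for v by (auto simp: in_arcs_def out_arcs_def intro!: sum.cong)
    have "?g \<in> K"
      using g by (auto simp: K_def S_def is_flow_def eq)
    then show ?thesis
      using f(2)[of ?g] by (simp add: flow_value_def eq)
  qed
  moreover have "is_flow G c x y f"
    using f(1) by (auto simp: K_def S_def is_flow_def split: if_splits)
  ultimately show ?thesis
    unfolding is_max_flow_def is_arg_max_linorder by blast
qed

section \<open>The battery charging game\<close>

text \<open>The fields \<open>edge_cap\<close>, \<open>net_supply\<close> and \<open>bat_cap\<close> hold
  \<open>\<kappa>(e\<^sub>t)\<close>, \<open>d(v\<^sub>t)\<close> and \<open>\<kappa>((b\<^sub>t, b\<^sub>t\<^sub>+\<^sub>1))\<close>; times run from \<open>1\<close> to \<open>horizon\<close>.\<close>

record ('v, 'b) battery_game =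
  horizon :: nat
  base_graph :: "'v pair_pre_digraph"
  edge_cap :: "'v \<times> 'v \<Rightarrow> nat \<Rightarrow> real"
  net_supply :: "'v \<Rightarrow> nat \<Rightarrow> real"
  agents :: "'b set"
  location :: "'b \<Rightarrow> 'v"
  bat_cap :: "'b \<Rightarrow> nat \<Rightarrow> real"

definition battery_instance :: "('v, 'b) battery_game \<Rightarrow> bool" where
  "battery_instance I \<longleftrightarrow>
     pair_fin_digraph (base_graph I) \<and>
     (\<forall>e\<in>parcs (base_graph I). \<forall>t\<in>{1..horizon I}. 0 \<le> edge_cap I e t) \<and>
     finite (agents I) \<and>
     (\<forall>b\<in>agents I. location I b \<in> pverts (base_graph I)) \<and>
     (\<forall>b\<in>agents I. \<forall>t\<in>{1..<horizon I}. 0 \<le> bat_cap I b t)"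

datatype ('v, 'b) node = Source | Target | Copy 'v nat | Battery 'b nat

definition network :: "('v, 'b) battery_game \<Rightarrow> ('v, 'b) node pair_pre_digraph" where
  "network I =
     \<lparr> pverts =
         {Source, Target}
         \<union> {Copy v t | v t. v \<in> pverts (base_graph I) \<and> t \<in> {1..horizon I}}
         \<union> {Battery b t | b t. b \<in> agents I \<and> t \<in> {1..horizon I}},
       parcs =
         {(Copy u t, Copy v t) | u v t. (u, v) \<in> parcs (base_graph I) \<and> t \<in> {1..horizon I}}
         \<union> {(Battery b t, Battery b (t + 1)) | b t. b \<in> agents I \<and> t \<in> {1..<horizon I}}
         \<union> {(Battery b t, Copy (location I b) t) | b t. b \<in> agents I \<and> t \<in> {1..horizon I}}
         \<union> {(Copy (location I b) t, Battery b t) | b t. b \<in> agents I \<and> t \<in> {1..horizon I}}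
         \<union> {(Source, Copy v t) | v t. v \<in> pverts (base_graph I) \<and> t \<in> {1..horizon I}}
         \<union> {(Copy v t, Target) | v t. v \<in> pverts (base_graph I) \<and> t \<in> {1..horizon I}} \<rparr>"

text \<open>A strategy profile assigns the real \<open>s b t\<close> to each agent \<open>b\<close> and time \<open>t\<close>; only
  its values at agents and at times in \<open>{1..horizon I}\<close> matter.  The last time step carries
  no constraint.\<close>

definition is_strategy :: "('v, 'b) battery_game \<Rightarrow> 'b \<Rightarrow> (nat \<Rightarrow> real) \<Rightarrow> bool" where
  "is_strategy I b \<sigma> \<longleftrightarrow>
     (\<forall>t\<in>{1..<horizon I}. 0 \<le> (\<Sum>z\<in>{1..t}. \<sigma> z) \<and> (\<Sum>z\<in>{1..t}. \<sigma> z) \<le> bat_cap I b t)"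

definition strategy_profile :: "('v, 'b) battery_game \<Rightarrow> ('b \<Rightarrow> nat \<Rightarrow> real) \<Rightarrow> bool" where
  "strategy_profile I s \<longleftrightarrow> (\<forall>b\<in>agents I. is_strategy I b (s b))"

text \<open>The capacities \<open>\<kappa>\<^sub>s\<close>.  The infinite capacities of the transaction edges under \<open>\<kappa>\<close>
  are always overridden, so real capacities suffice.  The final equation only concerns
  pairs that are not arcs of the network.\<close>

fun capacity ::
    "('v, 'b) battery_game \<Rightarrow> ('b \<Rightarrow> nat \<Rightarrow> real) \<Rightarrow> ('v, 'b) node \<times> ('v, 'b) node \<Rightarrow> real" where
  "capacity I s (Copy u t, Copy v t') = edge_cap I (u, v) t"
| "capacity I s (Battery b t, Battery b' t') = bat_cap I b t"
| "capacity I s (Copy v t, Battery b t') = max 0 (s b t')"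
| "capacity I s (Battery b t, Copy v t') = max 0 (- s b t)"
| "capacity I s (Source, Copy v t) = max 0 (net_supply I v t)"
| "capacity I s (Copy v t, Target) = max 0 (- net_supply I v t)"
| "capacity I s _ = 0"

abbreviation game_max_flow ::
    "('v, 'b) battery_game \<Rightarrow> ('b \<Rightarrow> nat \<Rightarrow> real) \<Rightarrow> (('v, 'b) node \<times> ('v, 'b) node \<Rightarrow> real) \<Rightarrow> bool"
  where "game_max_flow I s \<equiv> is_max_flow (network I) (capacity I s) Source Target"

definition welfare :: "('v, 'b) battery_game \<Rightarrow> ('b \<Rightarrow> nat \<Rightarrow> real) \<Rightarrow> real" where
  "welfare I s = max_flow_value (network I) (capacity I s) Source Target"

definition OPT :: "('v, 'b) battery_game \<Rightarrow> 'b \<Rightarrow> nat \<Rightarrow> real" where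
  "OPT I = arg_max (welfare I) (strategy_profile I)"

definition transaction_edges ::
    "('v, 'b) battery_game \<Rightarrow> 'b \<Rightarrow> (('v, 'b) node \<times> ('v, 'b) node) set" where
  "transaction_edges I b =
     (\<Union>t\<in>{1..horizon I}. {(Battery b t, Copy (location I b) t), (Copy (location I b) t, Battery b t)})"

lemma network_fin_digraph:
  assumes "battery_instance I"
  shows "pair_fin_digraph (network I)"
proof -
  interpret H: pair_fin_digraph "base_graph I"
    using assms by (simp add: battery_instance_def)
  let ?T = "{1..horizon I}"
  have fin: "finite (agents I)"
    using assms by (simp add: battery_instance_def)
  have "pverts (network I) \<subseteq> {Source, Target}
      \<union> (\<lambda>(v, t). Copy v t) ` (pverts (base_graph I) \<times> ?T) \<union> (\<lambda>(b, t). Battery b t) ` (agents I \<times> ?T)"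
    by (auto simp: network_def)
  then have fV: "finite (pverts (network I))"
    by (rule finite_subset) (auto simp: fin H.pair_finite_verts)
  have loc: "\<And>b. b \<in> agents I \<Longrightarrow> location I b \<in> pverts (base_graph I)"
    using assms by (simp add: battery_instance_def)
  have sub: "fst e \<in> pverts (network I) \<and> snd e \<in> pverts (network I)"
    if "e \<in> parcs (network I)" for e
    using that loc by (auto simp: network_def dest: H.in_arcsD1 H.in_arcsD2)
  then have "parcs (network I) \<subseteq> pverts (network I) \<times> pverts (network I)"
    by (metis mem_Times_iff subsetI)
  then have "finite (parcs (network I))"
    using fV by (meson finite_SigmaI finite_subset)
  then show ?thesis
    using sub fV by (simp add: pair_fin_digraph_def pair_wf_digraph_def pair_fin_digraph_axioms_def)
qed

lemma capacity_nonneg: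
  assumes "battery_instance I" and "e \<in> parcs (network I)"
  shows "0 \<le> capacity I s e"
  using assms by (auto simp: network_def battery_instance_def)

lemma welfare_is_max:
  assumes "battery_instance I"
  obtains f where "game_max_flow I s f" "welfare I s = flow_value (network I) Source f"
proof -
  have "game_max_flow I s (SOME f. game_max_flow I s f)"
    using max_flow_exists[OF network_fin_digraph[OF assms] capacity_nonneg[OF assms]]
    by (rule someI_ex)
  then show ?thesis
    by (intro that) (auto simp: welfare_def max_flow_value_def)
qed

lemma flow_value_le_welfare:
  assumes "battery_instance I" and "is_flow (network I) (capacity I s) Source Target f"
  shows "flow_value (network I) Source f \<le> welfare I s"
  using welfare_is_max[OF assms(1), of s] assms(2)
  by (metis is_arg_max_linorder is_max_flow_def)

lemma battery_conservation:
  assumes f: "is_flow (network I) c Source Target f"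
    and b: "b \<in> agents I" and t: "t \<in> {1..horizon I}"
  shows "f (Copy (location I b) t, Battery b t) + (if t = 1 then 0 else f (Battery b (t - 1), Battery b t))
       = f (Battery b t, Copy (location I b) t) + (if t = horizon I then 0 else f (Battery b t, Battery b (t + 1)))"
proof -
  have "in_arcs (network I) (Battery b t) = {(Copy (location I b) t, Battery b t)}
      \<union> (if t = 1 then {} else {(Battery b (t - 1), Battery b t)})"
    using b t by (auto simp: in_arcs_def network_def)
  moreover have "out_arcs (network I) (Battery b t) = {(Battery b t, Copy (location I b) t)}
      \<union> (if t = horizon I then {} else {(Battery b t, Battery b (t + 1))})"
    using b t by (auto simp: out_arcs_def network_def)
  moreover have "Battery b t \<in> pverts (network I) - {Source, Target}"
    using b t by (auto simp: network_def)
  then have "(\<Sum>e\<in>in_arcs (network I) (Battery b t). f e) = (\<Sum>e\<in>out_arcs (network I) (Battery b t). f e)"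
    using f unfolding is_flow_def by blast
  ultimately show ?thesis
    by (auto split: if_splits)
qed

lemma OPT_exists:
  fixes I :: "('v, 'b) battery_game"
  assumes I: "battery_instance I"
  shows "\<exists>s. is_arg_max (welfare I) (strategy_profile I) s"
proof -
  define N where "N = network I"
  define TE where "TE = (\<Union>b\<in>agents I. transaction_edges I b)"
  define M where "M = (\<Sum>b\<in>agents I. \<Sum>t\<in>{1..<horizon I}. bat_cap I b t)"
  define c where "c = (\<lambda>e. if e \<in> TE then M else capacity I (\<lambda>_ _. 0) e)"
  interpret N: pair_fin_digraph N
    unfolding N_def using I by (rule network_fin_digraph)
  have fin: "finite (agents I)" and nn: "\<And>b t. b \<in> agents I \<Longrightarrow> t \<in> {1..<horizon I} \<Longrightarrow> 0 \<le> bat_cap I b t"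
    using I by (auto simp: battery_instance_def)
  have M0: "0 \<le> M"
    unfolding M_def using nn by (intro sum_nonneg) auto
  have leM: "bat_cap I b t \<le> M" if b: "b \<in> agents I" and t: "t \<in> {1..<horizon I}" for b t
  proof -
    have "bat_cap I b t \<le> (\<Sum>t\<in>{1..<horizon I}. bat_cap I b t)"
      using nn[OF b] t by (intro member_le_sum) auto
    also have "\<dots> \<le> M"
      unfolding M_def using nn b fin by (intro member_le_sum[where f="\<lambda>b. \<Sum>t\<in>{1..<horizon I}. bat_cap I b t"] sum_nonneg) auto
    finally show ?thesis .
  qed
  have TE_iff: "e \<in> TE \<longleftrightarrow> (\<exists>b t. b \<in> agents I \<and> t \<in> {1..horizon I} \<and>
      (e = (Copy (location I b) t, Battery b t) \<or> e = (Battery b t, Copy (location I b) t)))" for e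
    unfolding TE_def transaction_edges_def by blast
  have TE_N: "TE \<subseteq> parcs N"
  proof
    fix e assume "e \<in> TE"
    then obtain b t where "b \<in> agents I" "t \<in> {1..horizon I}"
      "e = (Copy (location I b) t, Battery b t) \<or> e = (Battery b t, Copy (location I b) t)"
      unfolding TE_iff by blast
    then show "e \<in> parcs N"
      unfolding N_def network_def pair_pre_digraph.simps by blast
  qed
  have cap_indep: "capacity I s e = capacity I s' e" if "e \<in> parcs N" "e \<notin> TE" for s s' e
    using that unfolding TE_iff N_def network_def pair_pre_digraph.simps
    by (elim UnE CollectE exE conjE; simp; blast?)
  have c0: "0 \<le> c e" if "e \<in> parcs N" for e
    using that M0 capacity_nonneg[OF I] by (auto simp: c_def N_def)
  obtain f where "is_max_flow N c Source Target f"
    using max_flow_exists[OF N.pair_fin_digraph_axioms, of c Source Target] c0 by blast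
  then have f: "is_flow N c Source Target f"
    and fmax: "\<And>g. is_flow N c Source Target g \<Longrightarrow> flow_value N Source g \<le> flow_value N Source f"
    unfolding is_max_flow_def is_arg_max_linorder by auto
  define s where "s = (\<lambda>b t. f (Copy (location I b) t, Battery b t) - f (Battery b t, Copy (location I b) t))"
  define m where "m = (\<lambda>e. if e \<in> TE then min (f e) (f (prod.swap e)) else 0)"
  define g where "g = (\<lambda>e. f e - m e)"
  have TE_swap: "prod.swap e \<in> TE \<longleftrightarrow> e \<in> TE" for e
    unfolding TE_iff by (cases e) auto
  have m_swap: "m (prod.swap e) = m e" for e
    by (simp add: m_def TE_swap min.commute)
  have m_bal: "(\<Sum>e\<in>in_arcs N v. m e) = (\<Sum>e\<in>out_arcs N v. m e)" for v
  proof -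
    have "(\<Sum>e\<in>in_arcs N v. m e) = (\<Sum>e\<in>{e\<in>TE. snd e = v}. m e)"
      using TE_N N.finite_in_arcs[of v] by (intro sum.mono_neutral_right) (auto simp: in_arcs_def m_def)
    also have "\<dots> = (\<Sum>e\<in>{e\<in>TE. fst e = v}. m e)"
      by (rule sum.reindex_bij_witness[of _ prod.swap prod.swap]) (simp_all only: mem_Collect_eq TE_swap fst_swap snd_swap swap_swap m_swap simp_thms)
    also have "\<dots> = (\<Sum>e\<in>out_arcs N v. m e)"
      using TE_N N.finite_out_arcs[of v] by (intro sum.mono_neutral_left) (auto simp: out_arcs_def m_def)
    finally show ?thesis .
  qed
  have fnn: "0 \<le> f e \<and> f e \<le> c e" if "e \<in> parcs N" for e
    using f that by (auto simp: is_flow_def)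
  have g_flow: "is_flow N (capacity I s) Source Target g"
    unfolding is_flow_def
  proof (intro conjI ballI)
    fix e assume e: "e \<in> parcs N"
    show "0 \<le> g e"
      using fnn[OF e] by (auto simp: g_def m_def)
    show "g e \<le> capacity I s e"
    proof (cases "e \<in> TE")
      case True
      then show ?thesis
        unfolding TE_iff using True by (auto simp: g_def m_def s_def)
    next
      case False
      then show ?thesis
        using fnn[OF e] cap_indep[OF e False, of s "\<lambda>_ _. 0"] by (simp add: g_def m_def c_def)
    qed
  next
    fix v assume "v \<in> pverts N - {Source, Target}"
    then have "(\<Sum>e\<in>in_arcs N v. f e) = (\<Sum>e\<in>out_arcs N v. f e)"
      using f by (auto simp: is_flow_def)
    then show "(\<Sum>e\<in>in_arcs N v. g e) = (\<Sum>e\<in>out_arcs N v. g e)"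
      by (simp add: g_def sum_subtractf m_bal)
  qed
  have "flow_value N Source g = flow_value N Source f"
    unfolding flow_value_def by (rule sum.cong) (auto simp: out_arcs_def g_def m_def TE_iff)
  then have f_le: "flow_value N Source f \<le> welfare I s"
    using flow_value_le_welfare[OF I g_flow[unfolded N_def]] by (simp add: N_def)
  have "strategy_profile I s"
    unfolding strategy_profile_def is_strategy_def
  proof (intro ballI)
    fix b t assume b: "b \<in> agents I" and t: "t \<in> {1..<horizon I}"
    have "(\<Sum>z\<in>{1..t}. s b z) = f (Battery b t, Battery b (t + 1))" if "1 \<le> t" "t < horizon I" for t
      using that
    proof (induction t rule: dec_induct)
      case base
      then show ?case
        using battery_conservation[OF f[unfolded N_def] b, of 1] by (simp add: s_def)
    next
      case (step t)
      then show ?case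
        using battery_conservation[OF f[unfolded N_def] b, of "Suc t"] by (simp add: s_def)
    qed
    moreover have "(Battery b t, Battery b (t + 1)) \<in> parcs N"
      using b t by (auto simp: N_def network_def)
    moreover have "(Battery b t, Battery b (t + 1)) \<notin> TE"
      by (auto simp: TE_iff)
    ultimately show "0 \<le> (\<Sum>z\<in>{1..t}. s b z) \<and> (\<Sum>z\<in>{1..t}. s b z) \<le> bat_cap I b t"
      using fnn t by (auto simp: c_def dest!: fnn)
  qed
  moreover have "welfare I r \<le> welfare I s" for r
  proof -
    obtain h where h: "game_max_flow I r h" "welfare I r = flow_value N Source h"
      using welfare_is_max[OF I] N_def by metis
    then have hf: "is_flow N (capacity I r) Source Target h"
      by (simp add: is_max_flow_def is_arg_max_linorder N_def)
    then have hnn: "0 \<le> h e \<and> h e \<le> capacity I r e" if "e \<in> parcs N" for e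
      using that by (auto simp: is_flow_def)
    have "h e \<le> c e" if e: "e \<in> parcs N" for e
    proof (cases "e \<in> TE")
      case True
      then obtain b t where b: "b \<in> agents I" and t: "t \<in> {1..horizon I}"
        and e': "e = (Copy (location I b) t, Battery b t) \<or> e = (Battery b t, Copy (location I b) t)"
        unfolding TE_iff by blast
      have in1: "(Copy (location I b) t, Battery b t) \<in> parcs N" "(Battery b t, Copy (location I b) t) \<in> parcs N"
        using b t by (auto simp: N_def network_def)
      have prev: "0 \<le> h (Battery b (t - 1), Battery b t) \<and> h (Battery b (t - 1), Battery b t) \<le> M" if "t \<noteq> 1"
      proof -
        have "(Battery b (t - 1), Battery b t) \<in> parcs N"
          using b t that by (force simp: N_def network_def)
        then show ?thesis
          using hnn[of "(Battery b (t - 1), Battery b t)"] leM[OF b, of "t - 1"] t that by fastforce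
      qed
      have nxt: "0 \<le> h (Battery b t, Battery b (t + 1)) \<and> h (Battery b t, Battery b (t + 1)) \<le> M" if "t \<noteq> horizon I"
      proof -
        have "(Battery b t, Battery b (t + 1)) \<in> parcs N"
          using b t that by (force simp: N_def network_def)
        then show ?thesis
          using hnn[of "(Battery b t, Battery b (t + 1))"] leM[OF b, of t] t that by auto
      qed
      have one: "h (Copy (location I b) t, Battery b t) = 0 \<or> h (Battery b t, Copy (location I b) t) = 0"
        using hnn[OF in1(1)] hnn[OF in1(2)] by (auto simp: max_def split: if_splits)
      have "h e \<le> M"
        using e' one battery_conservation[OF hf[unfolded N_def] b t] prev nxt M0 hnn[OF in1(1)] hnn[OF in1(2)]
        by (smt (verit))
      then show ?thesis
        using True by (simp add: c_def)
    next
      case False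
      then show ?thesis
        using hnn[OF e] cap_indep[OF e False, of r "\<lambda>_ _. 0"] by (simp add: c_def)
    qed
    then have "is_flow N c Source Target h"
      using hf by (auto simp: is_flow_def)
    then show ?thesis
      using fmax f_le h(2) by fastforce
  qed
  ultimately show ?thesis
    unfolding is_arg_max_linorder by blast
qed

definition admissible_edge ::
    "('v, 'b) battery_game \<Rightarrow> ('b \<Rightarrow> nat \<Rightarrow> real) \<Rightarrow> ('v, 'b) node \<times> ('v, 'b) node \<Rightarrow> bool" where
  "admissible_edge I s e \<longleftrightarrow> (\<forall>f. game_max_flow I s f \<longrightarrow> f e = capacity I s e)"

definition admissible :: "('v, 'b) battery_game \<Rightarrow> ('b \<Rightarrow> nat \<Rightarrow> real) \<Rightarrow> 'b \<Rightarrow> bool" where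
  "admissible I s b \<longleftrightarrow> (\<forall>e\<in>transaction_edges I b. admissible_edge I s e)"

definition utility ::
    "('v, 'b) battery_game \<Rightarrow> 'b \<Rightarrow> ('b \<Rightarrow> nat \<Rightarrow> real) \<Rightarrow> (nat \<Rightarrow> real) \<Rightarrow> ereal" where
  "utility I b s p =
     (if admissible I s b then ereal (- (\<Sum>t\<in>{1..horizon I}. s b t * p t)) else -\<infinity>)"

definition strong_equilibrium ::
    "nat \<Rightarrow> ('v, 'b) battery_game \<Rightarrow> (nat \<Rightarrow> real) \<Rightarrow> ('b \<Rightarrow> nat \<Rightarrow> real) \<Rightarrow> bool" where
  "strong_equilibrium k I p s \<longleftrightarrow>
     strategy_profile I s \<and>
     \<not> (\<exists>C s'. C \<subseteq> agents I \<and> C \<noteq> {} \<and> card C \<le> k \<and> (\<forall>b\<in>C. is_strategy I b (s' b)) \<and>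
          (\<forall>b\<in>C. utility I b (override_on s s' C) p > utility I b s p))"

section \<open>Price of anarchy\<close>

definition welfare_ratio :: "real \<Rightarrow> real \<Rightarrow> ereal" where
  "welfare_ratio a b = (if b = 0 then (if a = 0 then 1 else \<infinity>) else ereal (a / b))"

text \<open>Price profiles are functions on \<open>nat\<close> of which only the values on \<open>{1..T}\<close> matter.
  Vertices and agents are natural numbers: every instance, being finite, is isomorphic to
  one of this form.\<close>

definition strong_PoA :: "nat \<Rightarrow> nat \<Rightarrow> (nat \<Rightarrow> real) set \<Rightarrow> ereal" where
  "strong_PoA T k P =
     (SUP I \<in> {I :: (nat, nat) battery_game. battery_instance I \<and> horizon I = T \<and>
                 (\<exists>p\<in>P. \<exists>s. strong_equilibrium k I p s)}.
      INF p \<in> {p \<in> P. \<exists>s. strong_equilibrium k I p s}.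
      SUP s \<in> {s. strong_equilibrium k I p s}.
        welfare_ratio (welfare I (OPT I)) (welfare I s))"

definition ANY :: "(nat \<Rightarrow> real) set" where
  "ANY = UNIV"

end

theory Submission
  imports Defs
begin

text \<open>Take a single vertex with one unit of supply at time \<open>1\<close> and one unit of demand at
  time \<open>T\<close>, and \<open>T - 1\<close> agents of which the \<open>b\<close>-th can store energy only between the times
  \<open>b\<close> and \<open>b + 1\<close>.  All agents together transport the unit, so the optimal welfare is positive.
  If some agent is idle, the network has a cut of capacity zero, so the zero flow is maximal and
  an admissible strategy must be zero.  Since a coalition of \<open>k \<le> T - 2\<close> agents leaves one agent
  idle, the zero profile, of welfare zero, is a \<open>k\<close>-strong equilibrium for all prices.\<close>

text \<open>Weak duality. Summing outflow minus inflow over \<open>S\<close>, conservation cancels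
  every vertex but \<open>x\<close>. As \<open>flow_value\<close> counts only the outflow of
  \<open>x\<close>, the assumption that no arc enters \<open>x\<close> makes it the net
  outflow.\<close>

lemma flow_value_le_cut:
  fixes G :: "'a pair_pre_digraph"
  assumes "pair_fin_digraph G" and f: "is_flow G c x y f"
    and S: "S \<subseteq> pverts G" "x \<in> S" "y \<notin> S" and "in_arcs G x = {}"
  shows "flow_value G x f \<le> (\<Sum>e\<in>{e \<in> parcs G. fst e \<in> S \<and> snd e \<notin> S}. c e)"
proof -
  interpret pair_fin_digraph G by fact
  have finS: "finite S"
    using S(1) pair_finite_verts finite_subset by blast
  have out: "(\<Sum>v\<in>S. sum f (out_arcs G v)) = sum f {e \<in> parcs G. fst e \<in> S}"
  proof -
    have "(\<Sum>v\<in>S. sum f (out_arcs G v)) = (\<Sum>v\<in>S. sum f {e \<in> {e \<in> parcs G. fst e \<in> S}. fst e = v})"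
      by (intro sum.cong refl arg_cong[of _ _ "sum f"]) (auto simp: out_arcs_def)
    also have "\<dots> = sum f {e \<in> parcs G. fst e \<in> S}"
      using pair_finite_arcs by (intro sum.group finS) auto
    finally show ?thesis .
  qed
  have in': "(\<Sum>v\<in>S. sum f (in_arcs G v)) = sum f {e \<in> parcs G. snd e \<in> S}"
  proof -
    have "(\<Sum>v\<in>S. sum f (in_arcs G v)) = (\<Sum>v\<in>S. sum f {e \<in> {e \<in> parcs G. snd e \<in> S}. snd e = v})"
      by (intro sum.cong refl arg_cong[of _ _ "sum f"]) (auto simp: in_arcs_def)
    also have "\<dots> = sum f {e \<in> parcs G. snd e \<in> S}"
      using pair_finite_arcs by (intro sum.group finS) auto
    finally show ?thesis .
  qed
  have nonneg: "0 \<le> f e" "f e \<le> c e" if "e \<in> parcs G" for e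
    using f that by (auto simp: is_flow_def)
  have "flow_value G x f = (\<Sum>v\<in>S. sum f (out_arcs G v) - sum f (in_arcs G v))"
  proof -
    have "(\<Sum>v\<in>S - {x}. sum f (out_arcs G v) - sum f (in_arcs G v)) = 0"
    proof (intro sum.neutral ballI)
      fix v assume "v \<in> S - {x}"
      then have "v \<in> pverts G - {x, y}"
        using S by auto
      then show "sum f (out_arcs G v) - sum f (in_arcs G v) = 0"
        using f unfolding is_flow_def by auto
    qed
    then show ?thesis
      using S(2) finS \<open>in_arcs G x = {}\<close> by (simp add: sum.remove flow_value_def)
  qed
  also have "\<dots> = sum f {e \<in> parcs G. fst e \<in> S} - sum f {e \<in> parcs G. snd e \<in> S}"
    by (simp only: sum_subtractf out in')
  \<comment> \<open>Arcs entering \<open>S\<close> from outside carry nonnegative flow, so leaving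
    them out of the subtracted sum only increases the difference.\<close>
  also have "\<dots> \<le> sum f {e \<in> parcs G. fst e \<in> S} - sum f {e \<in> parcs G. fst e \<in> S \<and> snd e \<in> S}"
    using nonneg pair_finite_arcs by (intro diff_left_mono sum_mono2) auto
  also have "\<dots> = sum f ({e \<in> parcs G. fst e \<in> S} - {e \<in> parcs G. fst e \<in> S \<and> snd e \<in> S})"
    using pair_finite_arcs by (subst sum_diff) auto
  also have "\<dots> = sum f {e \<in> parcs G. fst e \<in> S \<and> snd e \<notin> S}"
    by (rule arg_cong[of _ _ "sum f"]) auto
  also have "\<dots> \<le> sum c {e \<in> parcs G. fst e \<in> S \<and> snd e \<notin> S}"
    using nonneg by (intro sum_mono) auto
  finally show ?thesis .
qed

text \<open>At welfare zero the zero flow is maximum, so an admissible transaction edge has capacity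
  zero. For the two directions these capacities are the positive and the negative part of
  \<open>s b t\<close>.\<close>

lemma admissible_imp_zero:
  assumes "battery_instance I" and "welfare I s = 0"
    and "b \<in> agents I" and adm: "admissible I s b" and t: "t \<in> {1..horizon I}"
  shows "s b t = 0"
proof -
  have "is_flow (network I) (capacity I s) Source Target (\<lambda>_. 0)"
    using capacity_nonneg[OF assms(1)] by (auto simp: is_flow_def)
  then have "game_max_flow I s (\<lambda>_. 0)"
    using flow_value_le_welfare[OF assms(1), of s] \<open>welfare I s = 0\<close>
    by (auto simp: is_max_flow_def is_arg_max_linorder flow_value_def)
  then have "capacity I s e = 0" if "e \<in> transaction_edges I b" for e
    using adm that unfolding admissible_def admissible_edge_def by metis
  from this[of "(Copy (location I b) t, Battery b t)"] this[of "(Battery b t, Copy (location I b) t)"]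
  have "max 0 (s b t) = 0" "max 0 (- s b t) = 0"
    using t by (auto simp: transaction_edges_def)
  then show ?thesis
    by (simp add: max_def split: if_splits)
qed

text \<open>An edge of capacity zero is saturated by every flow.\<close>

lemma admissible_zero:
  assumes I: "battery_instance I" and b: "b \<in> agents I" and zero: "\<And>t. s b t = 0"
  shows "admissible I s b"
proof -
  have "f e = capacity I s e" if "game_max_flow I s f" and e: "e \<in> transaction_edges I b" for f e
  proof -
    have "e \<in> parcs (network I)"
      using e b by (auto simp: transaction_edges_def network_def)
    then have "0 \<le> f e" "f e \<le> capacity I s e"
      using that(1) by (auto simp: is_max_flow_def is_arg_max_linorder is_flow_def)
    moreover have "capacity I s e = 0"
      using e zero by (auto simp: transaction_edges_def)
    ultimately show ?thesis
      by simp
  qed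
  then show ?thesis
    by (simp add: admissible_def admissible_edge_def)
qed

text \<open>With one vertex and no base arcs, only batteries connect different times, and the
  passage from time \<open>b\<close> to \<open>b + 1\<close> rests on agent \<open>b\<close>
  alone.\<close>

definition relay :: "nat \<Rightarrow> (nat, nat) battery_game" where
  "relay T =
     \<lparr> horizon = T,
       base_graph = \<lparr> pverts = {0}, parcs = {} \<rparr>,
       edge_cap = (\<lambda>_ _. 0),
       net_supply = (\<lambda>_ t. if t = 1 then 1 else if t = T then - 1 else 0),
       agents = {1..<T},
       location = (\<lambda>_. 0),
       bat_cap = (\<lambda>b t. if t = b then 1 else 0) \<rparr>"

lemma relay_simps [simp]:
  "horizon (relay T) = T" "base_graph (relay T) = \<lparr> pverts = {0}, parcs = {} \<rparr>"
  "net_supply (relay T) v t = (if t = 1 then 1 else if t = T then - 1 else 0)"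
  "agents (relay T) = {1..<T}" "location (relay T) b = 0"
  "bat_cap (relay T) b t = (if t = b then 1 else 0)"
  by (simp_all add: relay_def)

lemma relay_instance: "battery_instance (relay T)"
  by (simp add: battery_instance_def pair_fin_digraph_def pair_wf_digraph_def pair_fin_digraph_axioms_def)

lemma parcs_relay: "e \<in> parcs (network (relay T)) \<longleftrightarrow>
    (\<exists>b t. b \<in> {1..<T} \<and> t \<in> {1..<T} \<and> e = (Battery b t, Battery b (t + 1)))
    \<or> (\<exists>b t. b \<in> {1..<T} \<and> t \<in> {1..T} \<and> e = (Battery b t, Copy 0 t))
    \<or> (\<exists>b t. b \<in> {1..<T} \<and> t \<in> {1..T} \<and> e = (Copy 0 t, Battery b t))
    \<or> (\<exists>t. t \<in> {1..T} \<and> e = (Source, Copy 0 t))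
    \<or> (\<exists>t. t \<in> {1..T} \<and> e = (Copy 0 t, Target))"
  unfolding network_def by auto

lemma pverts_relay: "v \<in> pverts (network (relay T)) \<longleftrightarrow> v = Source \<or> v = Target
    \<or> (\<exists>t. t \<in> {1..T} \<and> v = Copy 0 t) \<or> (\<exists>b t. b \<in> {1..<T} \<and> t \<in> {1..T} \<and> v = Battery b t)"
  unfolding network_def by auto

lemma relay_welfare_idle:
  assumes j: "j \<in> {1..<T}" and idle: "\<And>t. s j t = 0"
  shows "welfare (relay T) s = 0"
proof -
  let ?N = "network (relay T)" and ?c = "capacity (relay T) s"
  \<comment> \<open>All nodes up to time \<open>j\<close>, without those of agent \<open>j\<close>:
    its battery arc from \<open>j\<close> to \<open>j + 1\<close> has capacity 1 and must not cross
    the cut.\<close>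
  define S :: "(nat, nat) node set" where "S = insert Source (Copy 0 ` {1..j} \<union> (\<lambda>(b, t). Battery b t) ` (({1..<T} - {j}) \<times> {1..j}))"
  obtain f where f: "game_max_flow (relay T) s f" "welfare (relay T) s = flow_value ?N Source f"
    using welfare_is_max[OF relay_instance] by blast
  have flow: "is_flow ?N ?c Source Target f"
    using f(1) by (simp add: is_max_flow_def is_arg_max_linorder)
  \<comment> \<open>The leaving arcs are source arcs after time 1, target arcs before time
    \<open>T\<close>, charging arcs of the idle agent \<open>j\<close>, and battery arcs of agents
    other than \<open>j\<close> at time \<open>j\<close>.\<close>
  have "?c e = 0" if "e \<in> parcs ?N" "fst e \<in> S" "snd e \<notin> S" for e
    using that j idle unfolding parcs_relay S_def by (elim disjE exE conjE) (auto simp: image_iff)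
  then have "(\<Sum>e\<in>{e \<in> parcs ?N. fst e \<in> S \<and> snd e \<notin> S}. ?c e) = 0"
    by (intro sum.neutral) auto
  moreover have "S \<subseteq> pverts ?N" "Source \<in> S" "Target \<notin> S" "in_arcs ?N Source = {}"
    using j by (auto simp: S_def pverts_relay in_arcs_def parcs_relay)
  ultimately have "flow_value ?N Source f \<le> 0"
    using flow_value_le_cut[OF network_fin_digraph[OF relay_instance] flow, of S] by linarith
  moreover have "0 \<le> flow_value ?N Source f"
    using flow unfolding flow_value_def by (intro sum_nonneg) (auto simp: is_flow_def out_arcs_def)
  ultimately show ?thesis
    using f(2) by simp
qed

lemma relay_zero_equilibrium:
  assumes "Suc k < T"
  shows "strong_equilibrium k (relay T) p (\<lambda>_ _. 0)"
proof -
  let ?z = "\<lambda>_ _. 0 :: real"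
  have unprofitable: "\<exists>b\<in>C. utility (relay T) b (override_on ?z s' C) p \<le> utility (relay T) b ?z p"
    if C: "C \<subseteq> {1..<T}" "C \<noteq> {}" "card C \<le> k" for C and s' :: "nat \<Rightarrow> nat \<Rightarrow> real"
  proof -
    let ?s = "override_on ?z s' C"
    from C(2) obtain b where b: "b \<in> C" by blast
    \<comment> \<open>There are \<open>T - 1\<close> agents, more than \<open>k\<close>.\<close>
    have "C \<noteq> {1..<T}"
      using C(3) assms by auto
    then obtain j where j: "j \<in> {1..<T}" "j \<notin> C"
      using C(1) by blast
    then have welf: "welfare (relay T) ?s = 0"
      by (intro relay_welfare_idle) auto
    have z: "utility (relay T) b ?z p = 0"
      using admissible_zero[OF relay_instance, of b T ?z] C(1) b by (auto simp: utility_def)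
    \<comment> \<open>Hence the deviation yields \<open>b\<close> either 0 or
      \<open>-\<infinity>\<close>, whatever the prices.\<close>
    have "?s b t = 0" if "admissible (relay T) ?s b" "t \<in> {1..T}" for t
      using admissible_imp_zero[OF relay_instance welf _ that(1)] that(2) C(1) b by auto
    then have "utility (relay T) b ?s p \<le> 0"
      by (simp add: utility_def)
    with z have "utility (relay T) b ?s p \<le> utility (relay T) b ?z p"
      by simp
    with b show ?thesis
      by blast
  qed
  have "strategy_profile (relay T) ?z"
    by (simp add: strategy_profile_def is_strategy_def)
  then show ?thesis
    unfolding strong_equilibrium_def relay_simps not_ex de_Morgan_conj
    using unprofitable by (meson not_le)
qed

lemma relay_OPT_pos:
  assumes T: "T > 1"
  shows "0 < welfare (relay T) (OPT (relay T))"
proof -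
  let ?N = "network (relay T)"
  \<comment> \<open>Agent \<open>b\<close> charges one unit at time \<open>b\<close> and hands it on
    at \<open>b + 1\<close>. The set \<open>P\<close> below is the resulting path from source to
    target, and \<open>f\<close> sends one unit along it.\<close>
  define s :: "nat \<Rightarrow> nat \<Rightarrow> real" where "s b t = (if t = b then 1 else if t = b + 1 then - 1 else 0)" for b t
  define P :: "((nat, nat) node \<times> (nat, nat) node) set" where
    "P = {(Source, Copy 0 1), (Copy 0 T, Target)} \<union>
      (\<Union>b\<in>{1..<T}. {(Copy 0 b, Battery b b), (Battery b b, Battery b (b + 1)), (Battery b (b + 1), Copy 0 (b + 1))})"
  define f :: "(nat, nat) node \<times> (nat, nat) node \<Rightarrow> real" where "f e = of_bool (e \<in> P)" for e
  interpret pair_fin_digraph ?N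
    by (rule network_fin_digraph[OF relay_instance])
  \<comment> \<open>The sum starts at time 1, so \<open>b \<ge> 1\<close> keeps the charging step
    inside it; the prefix sums then equal \<open>bat_cap\<close>.\<close>
  have prefix: "(\<Sum>z\<in>{1..t}. s b z) = (if t = b then 1 else 0)" if "b \<ge> 1" for b t
    using that by (induction t) (auto simp: s_def)
  then have prof: "strategy_profile (relay T) s"
    by (auto simp: strategy_profile_def is_strategy_def)
  \<comment> \<open>As \<open>f\<close> is the indicator of \<open>P\<close>, conservation becomes a
    count of path arcs.\<close>
  have sum_f: "sum f (in_arcs ?N v) = real (card (in_arcs ?N v \<inter> P))"
    "sum f (out_arcs ?N v) = real (card (out_arcs ?N v \<inter> P))" for v
    using finite_in_arcs[of v] finite_out_arcs[of v] by (simp_all add: f_def Int_def)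
  have bal: "card (in_arcs ?N v \<inter> P) = card (out_arcs ?N v \<inter> P)"
    if v: "v \<in> pverts ?N - {Source, Target}" for v
  proof -
    consider (copy) t where "t \<in> {1..T}" "v = Copy 0 t"
      | (battery) b t where "b \<in> {1..<T}" "t \<in> {1..T}" "v = Battery b t"
      using v by (auto simp: pverts_relay)
    then show ?thesis
    proof cases
      case copy
      \<comment> \<open>At time \<open>t\<close> agent \<open>t - 1\<close> delivers and agent
        \<open>t\<close> takes over; the source at time 1 and the target at time \<open>T\<close>
        close the two ends.\<close>
      then have "in_arcs ?N v \<inter> P = {if t = 1 then (Source, Copy 0 1) else (Battery (t - 1) t, Copy 0 t)}"
        by (auto simp: in_arcs_def P_def parcs_relay split: if_splits)
      moreover have "out_arcs ?N v \<inter> P = {if t = T then (Copy 0 T, Target) else (Copy 0 t, Battery t t)}"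
        using copy T by (auto simp: out_arcs_def P_def parcs_relay split: if_splits)
      ultimately show ?thesis
        by simp
    next
      case battery
      then have "in_arcs ?N v \<inter> P = (if t = b then {(Copy 0 b, Battery b b)}
          else if t = b + 1 then {(Battery b b, Battery b (b + 1))} else {})"
        by (auto simp: in_arcs_def P_def parcs_relay)
      moreover have "out_arcs ?N v \<inter> P = (if t = b then {(Battery b b, Battery b (b + 1))}
          else if t = b + 1 then {(Battery b (b + 1), Copy 0 (b + 1))} else {})"
        using battery by (auto simp: out_arcs_def P_def parcs_relay)
      ultimately show ?thesis
        by simp
    qed
  qed
  \<comment> \<open>Every arc of \<open>P\<close> has capacity exactly 1; \<open>T > 1\<close> makes
    the supply and the demand fall on different times.\<close>
  have "f e \<le> capacity (relay T) s e" if "e \<in> parcs ?N" for e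
  proof (cases "e \<in> P")
    case True
    then show ?thesis
      using T by (auto simp: f_def P_def s_def)
  next
    case False
    then show ?thesis
      using capacity_nonneg[OF relay_instance that] by (simp add: f_def)
  qed
  then have "is_flow ?N (capacity (relay T) s) Source Target f"
    using bal unfolding is_flow_def sum_f by (auto simp: f_def)
  then have "flow_value ?N Source f \<le> welfare (relay T) s"
    by (rule flow_value_le_welfare[OF relay_instance])
  moreover have "out_arcs ?N Source \<inter> P = {(Source, Copy 0 1)}"
    using T by (auto simp: out_arcs_def P_def parcs_relay)
  then have "flow_value ?N Source f = 1"
    by (simp add: flow_value_def sum_f)
  moreover have "welfare (relay T) s \<le> welfare (relay T) (OPT (relay T))"
  proof -
    \<comment> \<open>\<open>OPT\<close> is a choice among maximizers, so its optimality rests on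
      the existence of one.\<close>
    have "is_arg_max (welfare (relay T)) (strategy_profile (relay T)) (OPT (relay T))"
      unfolding OPT_def arg_max_def using OPT_exists[OF relay_instance] by (rule someI_ex)
    then show ?thesis
      using prof by (simp add: is_arg_max_linorder)
  qed
  ultimately show ?thesis
    by simp
qed

theorem theorem8:
  fixes T k :: nat
  assumes "T > 2" and "1 \<le> k" and "k \<le> T - 2"
  shows "strong_PoA T k ANY = \<infinity>"
proof -
  have eq: "strong_equilibrium k (relay T) p (\<lambda>_ _. 0)" for p
    using assms by (intro relay_zero_equilibrium) auto
  have "welfare (relay T) (\<lambda>_ _. 0) = 0"
    using assms(1) by (intro relay_welfare_idle[of 1]) auto
  moreover have "0 < welfare (relay T) (OPT (relay T))"
    using assms(1) by (intro relay_OPT_pos) auto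
  ultimately have ratio: "welfare_ratio (welfare (relay T) (OPT (relay T))) (welfare (relay T) (\<lambda>_ _. 0)) = \<infinity>"
    by (simp add: welfare_ratio_def)
  have "\<infinity> \<le> strong_PoA T k ANY"
    unfolding strong_PoA_def
  proof (rule SUP_upper2[of "relay T"])
    show "relay T \<in> {I. battery_instance I \<and> horizon I = T \<and> (\<exists>p\<in>ANY. \<exists>s. strong_equilibrium k I p s)}"
      using eq relay_instance by (auto simp: ANY_def)
    \<comment> \<open>The zero profile is an equilibrium for each \<open>p\<close>, so every inner
      supremum already contains the ratio \<open>\<infinity>\<close>.\<close>
    show "\<infinity> \<le> (INF p\<in>{p \<in> ANY. \<exists>s. strong_equilibrium k (relay T) p s}.
        SUP s\<in>{s. strong_equilibrium k (relay T) p s}.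
          welfare_ratio (welfare (relay T) (OPT (relay T))) (welfare (relay T) s))"
      using eq ratio by (intro INF_greatest SUP_upper2[of "\<lambda>_ _. 0"]) auto
  qed
  then show ?thesis
    by simp
qed

end
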